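(* Let $(P,\rho)$ be a weakly ranked locally finite poset and let $\kappa$ be a $(P,\rho)$-kernel, with right KLS function $f$, left KLS function $g$, and Chow function $\mathrm{H}$. If $f_{st}(x)$ has non-negative coefficients for all $s\le t$ in $P$, or if $g_{st}(x)$ has non-negative coefficients for all $s\le t$ in $P$, then for every $s\le t$ in $P$ the polynomial $\mathrm{H}_{st}(x)$ has non-negative coefficients and is unimodal.
   Context: $P$ is a locally finite poset; $\operatorname{Int}(P)$ is its set of closed intervals. A weak rank function is a map $\rho:\operatorname{Int}(P)\to\mathbb{Z}_{\ge0}$, $[s,t]\mapsto\rho_{st}$, with $\rho_{st}>0$ whenever $s<t$ and $\rho_{st}=\rho_{sw}+\rho_{wt}$ for $s\le w\le t$. The incidence algebra $\mathcal{I}(P)$ consists of maps $a$ assigning to each $[s,t]$ a polynomial $a_{st}(x)\in\mathbb{Z}[x]$, with product $(ab)_{st}=\sum_{s\le w\le t}a_{sw}b_{wt}$ and identity $\delta$ ($\delta_{ss}=1$, $\delta_{st}=0$ for $s<t$). $\mathcal{I}_\rho(P)=\{a\in\mathcal{I}(P):\deg a_{st}\le\rho_{st}\ \forall s\le t\}$, and for $a\in\mathcal{I}_\rho(P)$ define $a^{\mathrm{rev}}_{st}(x)=x^{\rho_{st}}a_{st}(x^{-1})$. A $(P,\rho)$-kernel is $\kappa\in\mathcal{I}_\rho(P)$ with $\kappa_{ss}=1$ for all $s$ and $\kappa^{-1}=\kappa^{\mathrm{rev}}$. For $s<t$, $\kappa_{st}(x)$ is divisible by $x-1$; the reduced kernel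 $\overline{\kappa}$ is given by $\overline{\kappa}_{st}=\kappa_{st}/(x-1)$ for $s<t$ and $\overline{\kappa}_{ss}=-1$. The ($\kappa$-)Chow function is $\mathrm{H}=-(\overline{\kappa})^{-1}$. The right KLS function is the unique $f\in\mathcal{I}_\rho(P)$ with $f_{ss}=1$, $\deg f_{st}<\rho_{st}/2$ for $s<t$, and $f^{\mathrm{rev}}=\kappa f$; the left KLS function is the unique $g\in\mathcal{I}_\rho(P)$ with $g_{ss}=1$, $\deg g_{st}<\rho_{st}/2$ for $s<t$, and $g^{\mathrm{rev}}=g\kappa$. A polynomial $a_0+\dots+a_mx^m$ with non-negative coefficients is unimodal if $a_0\le\dots\le a_j\ge a_{j+1}\ge\dots\ge a_m$ for some $j$. *)

theory Defs
  imports "HOL-Computational_Algebra.Polynomial"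
begin

text \<open>
  The poset is the universe of a type of class \<open>order\<close>. A map on closed intervals is a curried
  function of the two endpoints. For rank functions the values at pairs that do not
  satisfy \<open>s \<le> t\<close> are irrelevant and left unconstrained. Elements of the incidence algebra are
  required to vanish there, so that equality in the algebra is equality of functions.
\<close>

definition weak_rank :: "('a::order \<Rightarrow> 'a \<Rightarrow> nat) \<Rightarrow> bool" where
  "weak_rank \<rho> \<longleftrightarrow>
     (\<forall>s t. s < t \<longrightarrow> \<rho> s t > 0) \<and>
     (\<forall>s w t. s \<le> w \<longrightarrow> w \<le> t \<longrightarrow> \<rho> s t = \<rho> s w + \<rho> w t)"

definition incidence_algebra :: "('a::order \<Rightarrow> 'a \<Rightarrow> int poly) set" where
  "incidence_algebra = {a. \<forall>s t. \<not> s \<le> t \<longrightarrow> a s t = 0}"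

definition inc_one :: "'a::order \<Rightarrow> 'a \<Rightarrow> int poly" where
  "inc_one s t = (if s = t then 1 else 0)"

definition inc_mult ::
    "('a::order \<Rightarrow> 'a \<Rightarrow> int poly) \<Rightarrow> ('a \<Rightarrow> 'a \<Rightarrow> int poly) \<Rightarrow> 'a \<Rightarrow> 'a \<Rightarrow> int poly" where
  "inc_mult a b s t = (\<Sum>w\<in>{s..t}. a s w * b w t)"

text \<open>Only meaningful for invertible \<open>a\<close>, e.g. when every \<open>a s s\<close> is \<open>1\<close> or \<open>-1\<close> and intervals
  are finite.\<close>

definition inc_inverse :: "('a::order \<Rightarrow> 'a \<Rightarrow> int poly) \<Rightarrow> 'a \<Rightarrow> 'a \<Rightarrow> int poly" where
  "inc_inverse a =
     (THE b. b \<in> incidence_algebra \<and> inc_mult a b = inc_one \<and> inc_mult b a = inc_one)"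

text \<open>The zero polynomial has \<open>degree\<close> \<open>0\<close> here instead of minus infinity. This affects neither the
  bound below nor the strict bounds \<open>2 * degree (f s t) < \<rho> s t\<close> for \<open>s < t\<close>, since then
  \<open>\<rho> s t > 0\<close>.\<close>

definition ranked_incidence_algebra ::
    "('a::order \<Rightarrow> 'a \<Rightarrow> nat) \<Rightarrow> ('a \<Rightarrow> 'a \<Rightarrow> int poly) set" where
  "ranked_incidence_algebra \<rho> =
     {a \<in> incidence_algebra. \<forall>s t. s \<le> t \<longrightarrow> degree (a s t) \<le> \<rho> s t}"

text \<open>Since \<open>reflect_poly p\<close> is \<open>x ^ degree p * p (1/x)\<close>, this is \<open>x ^ \<rho> s t * a s t (1/x)\<close>
  for \<open>a\<close> in the ranked incidence algebra.\<close>

definition inc_rev ::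
    "('a::order \<Rightarrow> 'a \<Rightarrow> nat) \<Rightarrow> ('a \<Rightarrow> 'a \<Rightarrow> int poly) \<Rightarrow> 'a \<Rightarrow> 'a \<Rightarrow> int poly" where
  "inc_rev \<rho> a s t = monom 1 (\<rho> s t - degree (a s t)) * reflect_poly (a s t)"

definition is_kernel ::
    "('a::order \<Rightarrow> 'a \<Rightarrow> nat) \<Rightarrow> ('a \<Rightarrow> 'a \<Rightarrow> int poly) \<Rightarrow> bool" where
  "is_kernel \<rho> \<kappa> \<longleftrightarrow>
     \<kappa> \<in> ranked_incidence_algebra \<rho> \<and> (\<forall>s. \<kappa> s s = 1) \<and> inc_inverse \<kappa> = inc_rev \<rho> \<kappa>"

text \<open>The division is exact when \<open>\<kappa>\<close> is a kernel; \<open>[:-1, 1:]\<close> is \<open>x - 1\<close>.\<close>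

definition reduced_kernel :: "('a::order \<Rightarrow> 'a \<Rightarrow> int poly) \<Rightarrow> 'a \<Rightarrow> 'a \<Rightarrow> int poly" where
  "reduced_kernel \<kappa> s t =
     (if s = t then -1 else if s < t then \<kappa> s t div [:-1, 1:] else 0)"

definition chow_function :: "('a::order \<Rightarrow> 'a \<Rightarrow> int poly) \<Rightarrow> 'a \<Rightarrow> 'a \<Rightarrow> int poly" where
  "chow_function \<kappa> s t = - inc_inverse (reduced_kernel \<kappa>) s t"

definition is_right_KLS ::
    "('a::order \<Rightarrow> 'a \<Rightarrow> nat) \<Rightarrow> ('a \<Rightarrow> 'a \<Rightarrow> int poly) \<Rightarrow> ('a \<Rightarrow> 'a \<Rightarrow> int poly) \<Rightarrow> bool" where
  "is_right_KLS \<rho> \<kappa> f \<longleftrightarrow>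
     f \<in> ranked_incidence_algebra \<rho> \<and> (\<forall>s. f s s = 1) \<and>
     (\<forall>s t. s < t \<longrightarrow> 2 * degree (f s t) < \<rho> s t) \<and>
     inc_rev \<rho> f = inc_mult \<kappa> f"

definition is_left_KLS ::
    "('a::order \<Rightarrow> 'a \<Rightarrow> nat) \<Rightarrow> ('a \<Rightarrow> 'a \<Rightarrow> int poly) \<Rightarrow> ('a \<Rightarrow> 'a \<Rightarrow> int poly) \<Rightarrow> bool" where
  "is_left_KLS \<rho> \<kappa> g \<longleftrightarrow>
     g \<in> ranked_incidence_algebra \<rho> \<and> (\<forall>s. g s s = 1) \<and>
     (\<forall>s t. s < t \<longrightarrow> 2 * degree (g s t) < \<rho> s t) \<and>
     inc_rev \<rho> g = inc_mult g \<kappa>"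

definition nonneg_coeffs :: "int poly \<Rightarrow> bool" where
  "nonneg_coeffs p \<longleftrightarrow> (\<forall>i. coeff p i \<ge> 0)"

definition unimodal :: "int poly \<Rightarrow> bool" where
  "unimodal p \<longleftrightarrow>
     (\<exists>j\<le>degree p. (\<forall>i<j. coeff p i \<le> coeff p (Suc i)) \<and>
        (\<forall>i. j \<le> i \<longrightarrow> i < degree p \<longrightarrow> coeff p (Suc i) \<le> coeff p i))"

end

theory Submission
  imports Defs
begin

text \<open>
  Evaluating \<open>f\<^sup>r\<^sup>e\<^sup>v = \<kappa> f\<close> at \<open>1\<close> shows that \<open>\<kappa>\<close> becomes the identity there, so the division
  defining the reduced kernel \<open>\<kappa>'\<close> is exact: \<open>(x - 1) \<kappa>' = \<kappa> - x \<delta>\<close>. Hence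
  \<open>\<kappa>' f = B\<close> with \<open>(x - 1) B = f\<^sup>r\<^sup>e\<^sup>v - x f\<close>, and multiplication by \<open>H\<close> gives \<open>H B = - f\<close>. For
  \<open>s < t\<close> this says that \<open>H\<^sub>s\<^sub>t\<close> is \<open>f\<^sub>s\<^sub>t + B\<^sub>s\<^sub>t\<close> plus the sum of \<open>H\<^sub>s\<^sub>w B\<^sub>w\<^sub>t\<close> over \<open>s < w < t\<close>.
  A term \<open>c x\<^sup>i\<close> of \<open>f\<^sub>w\<^sub>t\<close>, where \<open>\<rho>\<^sub>w\<^sub>t = r\<close>, contributes \<open>c (x ^ (i + 1) + \<dots> + x ^ (r - 1 - i))\<close> to
  \<open>B\<^sub>w\<^sub>t\<close> and \<open>c (x ^ i + \<dots> + x ^ (r - 1 - i))\<close> to \<open>f\<^sub>w\<^sub>t + B\<^sub>w\<^sub>t\<close>. So by induction \<open>H\<^sub>s\<^sub>t\<close> is a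
  non-negative combination of runs of consecutive powers centred at \<open>(\<rho>\<^sub>s\<^sub>t - 1) / 2\<close>. The argument
  for \<open>g\<close> is dual.
\<close>

section \<open>Centred polynomials\<close>

definition geom_poly :: "nat \<Rightarrow> int poly" where
  "geom_poly l = (\<Sum>k<l. monom 1 k)"

lemma geom_poly_0 [simp]: "geom_poly 0 = 0"
  by (simp add: geom_poly_def)

lemma geom_poly_Suc: "geom_poly (Suc l) = geom_poly l + monom 1 l"
  by (simp add: geom_poly_def)

lemma coeff_geom_poly: "coeff (geom_poly l) k = (if k < l then 1 else 0)"
  by (induction l) (auto simp: geom_poly_Suc)

lemma x_minus_one_mult_geom_poly: "[:-1, 1:] * geom_poly l = monom 1 l - 1"
proof (induction l)
  case (Suc l)
  have "[:-1, 1:] * monom 1 l = monom 1 (Suc l) - (monom 1 l :: int poly)"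
    by (simp add: monom_Suc)
  with Suc.IH show ?case
    by (simp only: geom_poly_Suc distrib_left)
qed simp

text \<open>After multiplication by (x - 1)^2 both sides become the same expression in x, x^a and
  x^b. The identity splits off the longest run, and the rest keeps the same centre.\<close>

lemma geom_poly_mult_Suc:
  "geom_poly (Suc a) * geom_poly (Suc b) =
     geom_poly (Suc (a + b)) + monom 1 1 * (geom_poly a * geom_poly b)"
proof -
  let ?X = "[:-1, 1:] :: int poly" and ?x = "monom 1 1 :: int poly"
  have X: "?X = ?x - 1"
    by (simp add: monom_Suc one_pCons)
  have pow: "monom 1 (Suc n) = ?x * monom 1 n"
    "monom 1 (n + m) = monom 1 n * (monom 1 m :: int poly)"
    for n m
    by (simp_all add: mult_monom)
  have "?X * ?X * (geom_poly (Suc a) * geom_poly (Suc b)) =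
      (?X * geom_poly (Suc a)) * (?X * geom_poly (Suc b))"
    by (simp only: mult_ac)
  also have "\<dots> = ?X * (?X * geom_poly (Suc (a + b)))
      + monom 1 1 * ((?X * geom_poly a) * (?X * geom_poly b))"
    unfolding x_minus_one_mult_geom_poly unfolding X pow by (simp only: algebra_simps)
  also have "\<dots> = ?X * ?X *
      (geom_poly (Suc (a + b)) + monom 1 1 * (geom_poly a * geom_poly b))"
    by (simp only: mult_ac distrib_left)
  finally show ?thesis
    by (simp only: mult_cancel_left) simp
qed

text \<open>The run \<open>x ^ i + \<dots> + x ^ (i + l - 1)\<close> has centre \<open>n / 2\<close> when \<open>2 * i + l = n + 1\<close>.\<close>

inductive_set centred :: "nat \<Rightarrow> int poly set" for n where
  zero: "0 \<in> centred n"
| run: "2 * i + l = Suc n \<Longrightarrow> monom 1 i * geom_poly l \<in> centred n"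
| add: "p \<in> centred n \<Longrightarrow> q \<in> centred n \<Longrightarrow> p + q \<in> centred n"

lemma centred_sum: "(\<And>i. i \<in> A \<Longrightarrow> h i \<in> centred n) \<Longrightarrow> sum h A \<in> centred n"
  by (induction A rule: infinite_finite_induct) (auto intro: centred.intros)

text \<open>The scalar is an integer, so scaling is repeated addition.\<close>

lemma centred_smult:
  assumes "p \<in> centred n" "c \<ge> 0"
  shows "smult c p \<in> centred n"
proof -
  have "smult (int k) p \<in> centred n" for k
    using assms(1) by (induction k) (auto simp: smult_add_left intro: centred.intros)
  from this[of "nat c"] show ?thesis
    using assms(2) by simp
qed

text \<open>Each use of \<open>geom_poly_mult_Suc\<close> splits off one run. The shift
  \<open>k\<close> grows by one while both lengths drop by one, so \<open>2 * k + a + b\<close>, and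
  with it the centre, stays fixed.\<close>

lemma centred_run_mult_run:
  "2 * k + a + b = n + 2 \<Longrightarrow> monom 1 k * (geom_poly a * geom_poly b) \<in> centred n"
proof (induction a arbitrary: b k)
  case 0
  then show ?case by (simp add: centred.zero)
next
  case (Suc a)
  show ?case
  proof (cases b)
    case 0
    then show ?thesis by (simp add: centred.zero)
  next
    case b: (Suc b')
    have "monom 1 k * (geom_poly (Suc a) * geom_poly b) =
        monom 1 k * geom_poly (Suc (a + b')) + monom 1 (Suc k) * (geom_poly a * geom_poly b')"
      unfolding b geom_poly_mult_Suc by (simp add: distrib_left mult_monom flip: mult.assoc)
    moreover have "monom 1 k * geom_poly (Suc (a + b')) \<in> centred n"
      using Suc.prems b by (intro centred.run) simp
    moreover have "monom 1 (Suc k) * (geom_poly a * geom_poly b') \<in> centred n"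
      using Suc.prems b by (intro Suc.IH) simp
    ultimately show ?thesis
      by (simp add: centred.add)
  qed
qed

text \<open>By bilinearity it suffices to multiply two runs, and their centres add.\<close>

lemma centred_mult:
  assumes "p \<in> centred m" "q \<in> centred n"
  shows "p * q \<in> centred (m + n)"
  using assms(1)
proof induction
  case (run i l)
  from assms(2) show ?case
  proof induction
    case (run j l')
    have "monom 1 i * geom_poly l * (monom 1 j * geom_poly l') =
        monom 1 i * monom 1 j * (geom_poly l * geom_poly l')"
      by (simp only: mult_ac)
    also have "\<dots> = monom 1 (i + j) * (geom_poly l * geom_poly l')"
      by (simp add: mult_monom)
    also have "\<dots> \<in> centred (m + n)"
      using \<open>2 * i + l = Suc m\<close> run by (intro centred_run_mult_run) simp
    finally show ?case .
  qed (auto simp: distrib_left intro: centred.intros)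
qed (auto simp: distrib_right intro: centred.intros)

text \<open>Runs have these properties, and sums inherit them because the turning point depends on
  \<open>n\<close> alone. For \<open>n = 2 * k + 1\<close> both inequalities apply: the two middle
  coefficients agree.\<close>

lemma centred_coeffs:
  assumes "p \<in> centred n"
  shows "coeff p k \<ge> 0"
    and "2 * k < n \<Longrightarrow> coeff p k \<le> coeff p (Suc k)"
    and "n \<le> Suc (2 * k) \<Longrightarrow> coeff p (Suc k) \<le> coeff p k"
proof -
  have "coeff p k \<ge> 0 \<and> (2 * k < n \<longrightarrow> coeff p k \<le> coeff p (Suc k)) \<and>
      (n \<le> Suc (2 * k) \<longrightarrow> coeff p (Suc k) \<le> coeff p k)"
    using assms
    by induction (auto simp: coeff_monom_mult coeff_geom_poly intro: add_mono)
  then show "coeff p k \<ge> 0"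
    and "2 * k < n \<Longrightarrow> coeff p k \<le> coeff p (Suc k)"
    and "n \<le> Suc (2 * k) \<Longrightarrow> coeff p (Suc k) \<le> coeff p k"
    by auto
qed

lemma centred_imp_nonneg_coeffs: "p \<in> centred n \<Longrightarrow> nonneg_coeffs p"
  by (simp add: nonneg_coeffs_def centred_coeffs)

lemma centred_imp_unimodal:
  assumes "p \<in> centred n"
  shows "unimodal p"
  unfolding unimodal_def
\<comment> \<open>The peak is at n / 2 rounded up. The minimum keeps it within the degree for the
  zero polynomial too.\<close>
proof (intro exI[of _ "min (Suc n div 2) (degree p)"] conjI allI impI)
  fix i
  show "coeff p i \<le> coeff p (Suc i)" if "i < min (Suc n div 2) (degree p)"
    using that assms by (intro centred_coeffs) auto
  show "coeff p (Suc i) \<le> coeff p i" if "min (Suc n div 2) (degree p) \<le> i" "i < degree p"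
    using that assms by (intro centred_coeffs) auto
qed simp

section \<open>Reversed polynomials\<close>

text \<open>For \<open>2 * degree p < n\<close> this is \<open>(x ^ n p(1/x) - x p(x)) / (x - 1)\<close>.\<close>

definition rev_quotient :: "nat \<Rightarrow> int poly \<Rightarrow> int poly" where
  "rev_quotient n p =
     (\<Sum>i\<le>degree p. smult (coeff p i) (monom 1 (Suc i) * geom_poly (n - Suc (2 * i))))"

lemma monom_mult_reflect_poly:
  fixes p :: "'a::comm_semiring_1 poly"
  assumes "degree p \<le> n"
  shows "monom 1 (n - degree p) * reflect_poly p = (\<Sum>i\<le>degree p. monom (coeff p i) (n - i))"
proof (rule poly_eqI)
  fix k
  have "coeff (\<Sum>i\<le>degree p. monom (coeff p i) (n - i)) k =
      (\<Sum>i\<le>degree p. if n - i = k then coeff p i else 0)"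
    by (simp add: coeff_sum)
  \<comment> \<open>The condition \<open>k \<le> n\<close> must be kept when solving for
    \<open>i\<close>, because truncated subtraction sends every larger \<open>k\<close> to
    \<open>i = 0\<close>.\<close>
  also have "\<dots> = (\<Sum>i\<le>degree p. if i = n - k then (if k \<le> n then coeff p i else 0) else 0)"
    using assms by (intro sum.cong) auto
  also have "\<dots> = (if k \<le> n \<and> n - k \<le> degree p then coeff p (n - k) else 0)"
    by simp
  also have "\<dots> = coeff (monom 1 (n - degree p) * reflect_poly p) k"
    using assms by (auto simp: coeff_monom_mult coeff_reflect_poly)
  finally show "coeff (monom 1 (n - degree p) * reflect_poly p) k =
      coeff (\<Sum>i\<le>degree p. monom (coeff p i) (n - i)) k" ..
qed

text \<open>Reversal only moves coefficients to other powers, and at 1 all powers agree.\<close>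

lemma poly_monom_mult_reflect_poly_1:
  fixes p :: "int poly"
  assumes "degree p \<le> n"
  shows "poly (monom 1 (n - degree p) * reflect_poly p) 1 = poly p 1"
  unfolding monom_mult_reflect_poly[OF assms] by (simp add: poly_sum poly_monom poly_altdef[of p])

text \<open>Each summand telescopes: the run from x ^ (i + 1) to x ^ (n - 1 - i) becomes x ^ (n - i)
  - x ^ (i + 1).\<close>

lemma x_minus_one_mult_rev_quotient:
  assumes "2 * degree p < n"
  shows "[:-1, 1:] * rev_quotient n p =
    monom 1 (n - degree p) * reflect_poly p - [:0, 1:] * p"
proof -
  have run: "[:-1, 1:] * smult (coeff p i) (monom 1 (Suc i) * geom_poly (n - Suc (2 * i))) =
      monom (coeff p i) (n - i) - [:0, 1:] * monom (coeff p i) i" if "i \<le> degree p" for i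
  proof -
    have "[:-1, 1:] * smult (coeff p i) (monom 1 (Suc i) * geom_poly (n - Suc (2 * i))) =
        smult (coeff p i) (monom 1 (Suc i) * ([:-1, 1:] * geom_poly (n - Suc (2 * i))))"
      by (simp only: mult_smult_right mult_ac)
    also have "\<dots> = smult (coeff p i) (monom 1 (Suc i + (n - Suc (2 * i))) - monom 1 (Suc i))"
      by (simp only: x_minus_one_mult_geom_poly right_diff_distrib mult_monom) simp
    \<comment> \<open>The truncated subtraction is exact because 2 * i < n.\<close>
    also have "Suc i + (n - Suc (2 * i)) = n - i"
      using assms that by simp
    finally show ?thesis
      by (simp add: smult_diff_right smult_monom monom_Suc)
  qed
  have "[:-1, 1:] * rev_quotient n p =
      (\<Sum>i\<le>degree p. monom (coeff p i) (n - i)) - [:0, 1:] * (\<Sum>i\<le>degree p. monom (coeff p i) i)"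
    unfolding rev_quotient_def sum_distrib_left sum_subtractf[symmetric]
    by (intro sum.cong refl run) simp
  then show ?thesis
    using assms by (simp only: poly_as_sum_of_monoms) (simp add: monom_mult_reflect_poly)
qed

text \<open>The end exponents i + 1 and n - 1 - i of each run sum to n.\<close>

lemma rev_quotient_centred:
  assumes "2 * degree p < n" "nonneg_coeffs p"
  shows "rev_quotient n p \<in> centred n"
  unfolding rev_quotient_def
proof (intro centred_sum centred_smult centred.run)
  show "2 * Suc i + (n - Suc (2 * i)) = Suc n" if "i \<in> {..degree p}" for i
    using that assms(1) by simp
qed (use assms(2) in \<open>simp add: nonneg_coeffs_def\<close>)

text \<open>The term x ^ i of \<open>p\<close> extends its run downwards by one power, which moves
  the centre to (n - 1) / 2.\<close>

lemma add_rev_quotient_centred: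
  assumes "2 * degree p < n" "nonneg_coeffs p"
  shows "p + rev_quotient n p \<in> centred (n - 1)"
proof -
  have run: "monom (coeff p i) i + smult (coeff p i) (monom 1 (Suc i) * geom_poly (n - Suc (2 * i))) =
      smult (coeff p i) (monom 1 i * geom_poly (n - 2 * i))" if "i \<le> degree p" for i
  proof -
    have "n - 2 * i = Suc (n - Suc (2 * i))"
      using assms(1) that by simp
    moreover have "geom_poly (Suc l) = 1 + monom 1 1 * geom_poly l" for l
      by (rule poly_eqI) (auto simp: coeff_geom_poly coeff_monom_mult)
    ultimately have "monom 1 i * geom_poly (n - 2 * i) =
        monom 1 i + monom 1 (Suc i) * geom_poly (n - Suc (2 * i))"
      by (simp add: distrib_left mult_monom flip: mult.assoc)
    then show ?thesis
      by (simp add: smult_add_right smult_monom)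
  qed
  have "p + rev_quotient n p = (\<Sum>i\<le>degree p. monom (coeff p i) i) + rev_quotient n p"
    by (simp only: poly_as_sum_of_monoms)
  also have "\<dots> = (\<Sum>i\<le>degree p. smult (coeff p i) (monom 1 i * geom_poly (n - 2 * i)))"
    unfolding rev_quotient_def sum.distrib[symmetric]
    by (intro sum.cong refl run) simp
  also have "\<dots> \<in> centred (n - 1)"
  proof (intro centred_sum centred_smult centred.run)
    show "2 * i + (n - 2 * i) = Suc (n - 1)" if "i \<in> {..degree p}" for i
      using that assms(1) by simp
  qed (use assms(2) in \<open>simp add: nonneg_coeffs_def\<close>)
  finally show ?thesis .
qed

section \<open>The incidence algebra\<close>

lemma inc_mult_diag [simp]: "inc_mult a b s s = a s s * b s s"
  by (simp add: inc_mult_def)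

lemma inc_mult_uminus_left: "inc_mult (\<lambda>s t. - a s t) b s t = - inc_mult a b s t"
  and inc_mult_uminus_right: "inc_mult a (\<lambda>s t. - b s t) s t = - inc_mult a b s t"
  by (simp_all add: inc_mult_def sum_negf)

lemma sum_interval_split:
  fixes s t :: "'a::order"
  assumes "finite {s..t}" "s < t"
  shows "sum h {s..t} = h s + h t + sum h {s<..<t}"
proof -
  have "{s..t} = insert s (insert t {s<..<t})"
    using assms(2) by (auto simp: less_le)
  moreover have "finite {s<..<t}"
    by (rule finite_subset[OF _ assms(1)]) auto
  ultimately show ?thesis
    using assms(2) by (simp add: add.assoc)
qed

text \<open>Non-empty intervals determine their endpoints. Their size is the measure for the
  recursion and the inductions below.\<close>

lemma card_interval_less:
  fixes s t v w :: "'a::order"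
  assumes "finite {s..t}" "s \<le> v" "v \<le> w" "w \<le> t" "v \<noteq> s \<or> w \<noteq> t"
  shows "card {v..w} < card {s..t}"
proof (intro psubset_card_mono assms(1) psubsetI)
  show "{v..w} \<subseteq> {s..t}"
    using assms(2,4) by auto
  show "{v..w} \<noteq> {s..t}"
    using assms(2-5) by (metis Icc_eq_Icc order.trans)
qed

section \<open>Associativity and inversion over finite intervals\<close>

context
  assumes locally_finite: "\<And>s t :: 'a::order. finite {s..t}"
begin

lemma inc_mult_assoc:
  fixes a b c :: "'a \<Rightarrow> 'a \<Rightarrow> int poly"
  shows "inc_mult (inc_mult a b) c = inc_mult a (inc_mult b c)"
proof (intro ext)
  fix s t :: 'a
  have "inc_mult (inc_mult a b) c s t = (\<Sum>w\<in>{s..t}. \<Sum>v\<in>{s..w}. a s v * b v w * c w t)"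
    by (simp add: inc_mult_def sum_distrib_right)
  \<comment> \<open>Once \<open>v\<close> ranges over the fixed set \<open>{s..t}\<close> subject to
    \<open>v \<le> w\<close>, the two sums can be exchanged.\<close>
  also have "\<dots> = (\<Sum>w\<in>{s..t}. \<Sum>v | v \<in> {s..t} \<and> v \<le> w. a s v * b v w * c w t)"
    by (intro sum.cong refl) auto
  also have "\<dots> = (\<Sum>v\<in>{s..t}. \<Sum>w | w \<in> {s..t} \<and> v \<le> w. a s v * b v w * c w t)"
    by (intro sum.swap_restrict locally_finite)
  also have "\<dots> = (\<Sum>v\<in>{s..t}. \<Sum>w\<in>{v..t}. a s v * b v w * c w t)"
    by (intro sum.cong refl) auto
  also have "\<dots> = inc_mult a (inc_mult b c) s t"
    by (simp add: inc_mult_def sum_distrib_left mult.assoc)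
  finally show "inc_mult (inc_mult a b) c s t = inc_mult a (inc_mult b c) s t" .
qed

lemma inc_mult_one:
  fixes a :: "'a \<Rightarrow> 'a \<Rightarrow> int poly"
  assumes "a \<in> incidence_algebra"
  shows "inc_mult inc_one a = a" "inc_mult a inc_one = a"
  using assms
  by (auto simp: inc_mult_def inc_one_def incidence_algebra_def locally_finite
      if_distrib[of "\<lambda>x. x * _"] if_distrib[of "\<lambda>x. _ * x"] cong: if_cong intro!: ext)

text \<open>Since \<open>a s s\<close> is a unit, the equation at \<open>s\<close> and
  \<open>t\<close> can be solved for \<open>b s t\<close> in terms of the \<open>b w t\<close> with
  s < w. The units on the diagonal of \<open>b\<close> allow the lemma to be applied to
  \<open>b\<close> in turn.\<close>

lemma right_inverse_exists:
  fixes a :: "'a \<Rightarrow> 'a \<Rightarrow> int poly"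
  assumes "\<And>s. a s s dvd 1"
  shows "\<exists>b \<in> incidence_algebra. inc_mult a b = inc_one \<and> (\<forall>s. b s s dvd 1)"
proof -
  from assms have "\<forall>s. \<exists>u. 1 = a s s * u"
    by (simp add: dvd_def)
  then obtain u where u: "\<And>s. a s s * u s = 1"
    by metis
  \<comment> \<open>Recursion on the size of the interval; the value 0 outside the order places
    \<open>b\<close> in the algebra.\<close>
  define R where "R = measure (\<lambda>(s, t :: 'a). card {s..t})"
  define F where "F = (\<lambda>h (s, t). if s \<le> t then u s * (inc_one s t -
    (\<Sum>w\<in>{s<..t}. a s w * h (w, t))) else 0)"
  define b where "b s t = wfrec R F (s, t)" for s t
  have b: "b s t = u s * (inc_one s t - (\<Sum>w\<in>{s<..t}. a s w * b w t))" if "s \<le> t" for s t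
  proof -
    have "b s t = F (cut (wfrec R F) R (s, t)) (s, t)"
      unfolding b_def by (rule wfrec) (simp add: R_def)
    also have "\<dots> = u s * (inc_one s t - (\<Sum>w\<in>{s<..t}. a s w * cut (wfrec R F) R (s, t) (w, t)))"
      using that by (simp add: F_def)
    also have "(\<Sum>w\<in>{s<..t}. a s w * cut (wfrec R F) R (s, t) (w, t)) =
        (\<Sum>w\<in>{s<..t}. a s w * b w t)"
      unfolding b_def
      by (intro sum.cong refl arg_cong2[of _ _ _ _ "(*)"] cut_apply)
        (auto simp: R_def intro!: card_interval_less locally_finite)
    finally show ?thesis .
  qed
  have alg: "b \<in> incidence_algebra"
    unfolding incidence_algebra_def b_def
    by (subst wfrec) (auto simp: R_def F_def wfrec)
  have "inc_mult a b s t = inc_one s t" for s t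
  proof (cases "s \<le> t")
    case True
    then have "{s..t} = insert s {s<..t}"
      by (auto simp: less_le)
    then have "inc_mult a b s t = a s s * b s t + (\<Sum>w\<in>{s<..t}. a s w * b w t)"
      using locally_finite[of s t] by (simp add: inc_mult_def)
    also have "a s s * b s t = inc_one s t - (\<Sum>w\<in>{s<..t}. a s w * b w t)"
      unfolding b[OF True] mult.assoc[symmetric] u by simp
    finally show ?thesis by simp
  next
    case False
    then show ?thesis by (auto simp: inc_mult_def inc_one_def)
  qed
  moreover have "b s s dvd 1" for s
    using b[of s s] u[of s] by (simp add: inc_one_def) (metis dvd_triv_right)
  ultimately show ?thesis
    using alg by (intro bexI[of _ b]) auto
qed

text \<open>If \<open>b\<close> is a right inverse of \<open>a\<close> and \<open>c\<close> one of
  \<open>b\<close>, then c = (a b) c = a (b c) = a. So \<open>b\<close> is a two-sided inverse,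
  hence the only one, and the definite description denotes it.\<close>

lemma inc_inverse:
  fixes a :: "'a \<Rightarrow> 'a \<Rightarrow> int poly"
  assumes a: "a \<in> incidence_algebra" and diag: "\<And>s. a s s dvd 1"
  shows "inc_mult a (inc_inverse a) = inc_one" "inc_mult (inc_inverse a) a = inc_one"
proof -
  obtain b where b: "b \<in> incidence_algebra" "inc_mult a b = inc_one" "\<And>s. b s s dvd 1"
    using right_inverse_exists[of a] diag by metis
  obtain c where c: "c \<in> incidence_algebra" "inc_mult b c = inc_one"
    using right_inverse_exists[of b] b(3) by metis
  have "c = a"
    using inc_mult_assoc[of a b c] a b c by (simp add: inc_mult_one)
  with c have ba: "inc_mult b a = inc_one"
    by simp
  have "inc_inverse a = b"
    unfolding inc_inverse_def
  proof (rule the_equality)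
    fix b'
    assume b': "b' \<in> incidence_algebra \<and> inc_mult a b' = inc_one \<and> inc_mult b' a = inc_one"
    then show "b' = b"
      using inc_mult_assoc[of b' a b] b by (simp add: inc_mult_one)
  qed (use b ba in simp)
  then show "inc_mult a (inc_inverse a) = inc_one" "inc_mult (inc_inverse a) a = inc_one"
    using b ba by simp_all
qed

section \<open>Kazhdan--Lusztig--Stanley functions and the Chow function\<close>

context
  fixes \<rho> :: "'a \<Rightarrow> 'a \<Rightarrow> nat" and \<kappa> f g :: "'a \<Rightarrow> 'a \<Rightarrow> int poly"
  assumes weak_rank: "weak_rank \<rho>"
    and kernel: "is_kernel \<rho> \<kappa>"
    and right_KLS: "is_right_KLS \<rho> \<kappa> f"
    and left_KLS: "is_left_KLS \<rho> \<kappa> g"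
begin

lemma rank_refl [simp]: "\<rho> s s = 0"
  using weak_rank unfolding weak_rank_def by (metis add_cancel_right_right order.refl)

lemma rank_add: "s \<le> w \<Longrightarrow> w \<le> t \<Longrightarrow> \<rho> s t = \<rho> s w + \<rho> w t"
  using weak_rank unfolding weak_rank_def by blast

lemma rank_pos: "s < t \<Longrightarrow> \<rho> s t > 0"
  using weak_rank unfolding weak_rank_def by blast

lemma kernel_refl [simp]: "\<kappa> s s = 1"
  using kernel by (simp add: is_kernel_def)

lemma kernel_incidence: "\<kappa> \<in> incidence_algebra"
  using kernel by (simp add: is_kernel_def ranked_incidence_algebra_def)

lemma KLS_refl [simp]: "f s s = 1" "g s s = 1"
  using right_KLS left_KLS by (simp_all add: is_right_KLS_def is_left_KLS_def)

lemma KLS_degree: "s < t \<Longrightarrow> 2 * degree (f s t) < \<rho> s t" "s < t \<Longrightarrow> 2 * degree (g s t) < \<rho> s t"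
  using right_KLS left_KLS by (simp_all add: is_right_KLS_def is_left_KLS_def)

lemma KLS_incidence: "f \<in> incidence_algebra" "g \<in> incidence_algebra"
  using right_KLS left_KLS
  by (simp_all add: is_right_KLS_def is_left_KLS_def ranked_incidence_algebra_def)

lemma KLS_rev: "inc_rev \<rho> f = inc_mult \<kappa> f" "inc_rev \<rho> g = inc_mult g \<kappa>"
  using right_KLS left_KLS by (simp_all add: is_right_KLS_def is_left_KLS_def)

section \<open>Divisibility of the kernel by x - 1\<close>

text \<open>In \<open>f\<^sup>r\<^sup>e\<^sup>v = \<kappa> f\<close> at 1, the inner terms vanish by
  induction on the interval, and the left side cancels against the term for
  \<open>w = s\<close>.\<close>

lemma poly_kernel_1: "s < t \<Longrightarrow> poly (\<kappa> s t) 1 = 0"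
proof (induction "card {s..t}" arbitrary: s t rule: less_induct)
  case less
  have "poly (f s t) 1 = poly (inc_rev \<rho> f s t) 1"
    unfolding inc_rev_def using KLS_degree(1)[OF less.prems]
    by (intro poly_monom_mult_reflect_poly_1[symmetric]) simp
  also have "\<dots> = poly (f s t) 1 + poly (\<kappa> s t) 1 +
      (\<Sum>w\<in>{s<..<t}. poly (\<kappa> s w) 1 * poly (f w t) 1)"
    unfolding KLS_rev inc_mult_def using less.prems
    by (simp add: sum_interval_split locally_finite poly_sum)
  also have "(\<Sum>w\<in>{s<..<t}. poly (\<kappa> s w) 1 * poly (f w t) 1) = 0"
    by (intro sum.neutral ballI)
      (auto simp: less.hyps[OF card_interval_less[OF locally_finite]] less_le)
  finally show ?case by simp
qed

text \<open>On the diagonal the value -1 of the reduced kernel gives 1 - x, which accounts for the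
  correction by x times the identity.\<close>

lemma x_minus_one_mult_reduced_kernel:
  "[:-1, 1:] * reduced_kernel \<kappa> s t = \<kappa> s t - [:0, 1:] * inc_one s t"
proof (cases "s < t")
  case True
  then have "[:-1, 1:] dvd \<kappa> s t"
    using poly_kernel_1[OF True] by (simp add: poly_eq_0_iff_dvd)
  then have "[:-1, 1:] * (\<kappa> s t div [:-1, 1:]) = \<kappa> s t"
    by (rule dvd_mult_div_cancel)
  then show ?thesis
    using True by (auto simp: reduced_kernel_def inc_one_def)
next
  case False
  then show ?thesis
    using kernel_incidence
    by (auto simp: reduced_kernel_def inc_one_def incidence_algebra_def less_le one_pCons)
qed

lemma x_minus_one_mult_reduced_kernel_KLS:
  "[:-1, 1:] * inc_mult (reduced_kernel \<kappa>) f s t = inc_rev \<rho> f s t - [:0, 1:] * f s t"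
  "[:-1, 1:] * inc_mult g (reduced_kernel \<kappa>) s t = inc_rev \<rho> g s t - [:0, 1:] * g s t"
proof -
  let ?x = "[:0, 1:] :: int poly"
  have "[:-1, 1:] * inc_mult (reduced_kernel \<kappa>) f s t =
      (\<Sum>w\<in>{s..t}. ([:-1, 1:] * reduced_kernel \<kappa> s w) * f w t)"
    unfolding inc_mult_def sum_distrib_left by (simp only: mult.assoc)
  also have "\<dots> = inc_mult \<kappa> f s t - ?x * inc_mult inc_one f s t"
    unfolding x_minus_one_mult_reduced_kernel inc_mult_def sum_distrib_left
    by (simp only: left_diff_distrib sum_subtractf mult.assoc)
  finally show "[:-1, 1:] * inc_mult (reduced_kernel \<kappa>) f s t = inc_rev \<rho> f s t - ?x * f s t"
    by (simp only: inc_mult_one KLS_incidence KLS_rev)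
  have "[:-1, 1:] * inc_mult g (reduced_kernel \<kappa>) s t =
      (\<Sum>w\<in>{s..t}. g s w * ([:-1, 1:] * reduced_kernel \<kappa> w t))"
    unfolding inc_mult_def sum_distrib_left by (simp only: mult.left_commute)
  also have "\<dots> = inc_mult g \<kappa> s t - ?x * inc_mult g inc_one s t"
    unfolding x_minus_one_mult_reduced_kernel inc_mult_def sum_distrib_left
    by (simp only: right_diff_distrib sum_subtractf mult.left_commute)
  finally show "[:-1, 1:] * inc_mult g (reduced_kernel \<kappa>) s t = inc_rev \<rho> g s t - ?x * g s t"
    by (simp only: inc_mult_one KLS_incidence KLS_rev)
qed

text \<open>Both sides agree after multiplication by x - 1. This fails on the diagonal, where the
  products are -1 but \<open>rev_quotient 0 1\<close> is 0.\<close>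

lemma reduced_kernel_KLS:
  assumes "s < t"
  shows "inc_mult (reduced_kernel \<kappa>) f s t = rev_quotient (\<rho> s t) (f s t)"
    and "inc_mult g (reduced_kernel \<kappa>) s t = rev_quotient (\<rho> s t) (g s t)"
proof -
  have "[:-1, 1:] * inc_mult (reduced_kernel \<kappa>) f s t = [:-1, 1:] * rev_quotient (\<rho> s t) (f s t)"
    "[:-1, 1:] * inc_mult g (reduced_kernel \<kappa>) s t = [:-1, 1:] * rev_quotient (\<rho> s t) (g s t)"
    unfolding x_minus_one_mult_reduced_kernel_KLS
      x_minus_one_mult_rev_quotient[OF KLS_degree(1)[OF assms]]
      x_minus_one_mult_rev_quotient[OF KLS_degree(2)[OF assms]]
    by (simp_all only: inc_rev_def)
  then show "inc_mult (reduced_kernel \<kappa>) f s t = rev_quotient (\<rho> s t) (f s t)"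
    "inc_mult g (reduced_kernel \<kappa>) s t = rev_quotient (\<rho> s t) (g s t)"
    by (simp_all only: mult_cancel_left) simp_all
qed

section \<open>Recursions for the Chow function\<close>

lemma reduced_kernel_refl [simp]: "reduced_kernel \<kappa> s s = -1"
  by (simp add: reduced_kernel_def)

lemma inverse_reduced_kernel:
  "inc_mult (reduced_kernel \<kappa>) (inc_inverse (reduced_kernel \<kappa>)) = inc_one"
  "inc_mult (inc_inverse (reduced_kernel \<kappa>)) (reduced_kernel \<kappa>) = inc_one"
  by (rule inc_inverse; simp add: incidence_algebra_def; auto simp: reduced_kernel_def)+

lemma chow_refl [simp]: "chow_function \<kappa> s s = 1"
  using fun_cong[OF fun_cong[OF inverse_reduced_kernel(1)], of s s]
  by (simp add: chow_function_def inc_one_def)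

lemma chow_mult_KLS:
  "inc_mult (chow_function \<kappa>) (inc_mult (reduced_kernel \<kappa>) f) s t = - f s t"
  "inc_mult (inc_mult g (reduced_kernel \<kappa>)) (chow_function \<kappa>) s t = - g s t"
proof -
  have chow: "chow_function \<kappa> = (\<lambda>s t. - inc_inverse (reduced_kernel \<kappa>) s t)"
    by (intro ext) (simp add: chow_function_def)
  show "inc_mult (chow_function \<kappa>) (inc_mult (reduced_kernel \<kappa>) f) s t = - f s t"
    unfolding chow inc_mult_uminus_left inc_mult_assoc[symmetric] inverse_reduced_kernel
    by (simp add: inc_mult_one KLS_incidence)
  show "inc_mult (inc_mult g (reduced_kernel \<kappa>)) (chow_function \<kappa>) s t = - g s t"
    unfolding chow inc_mult_uminus_right inc_mult_assoc inverse_reduced_kernel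
    by (simp add: inc_mult_one KLS_incidence)
qed

text \<open>In \<open>chow_mult_KLS\<close> the term for \<open>w = t\<close> is the negated Chow
  function, because the product of reduced kernel and \<open>f\<close> is -1 on the diagonal.
  Solving for it leaves \<open>f\<close> next to its quotient, and that sum has centre
  (\<open>\<rho> s t\<close> - 1) / 2.\<close>

lemma chow_recursion_right:
  assumes "s < t"
  shows "chow_function \<kappa> s t = (f s t + rev_quotient (\<rho> s t) (f s t)) +
    (\<Sum>w\<in>{s<..<t}. chow_function \<kappa> s w * rev_quotient (\<rho> w t) (f w t))"
proof -
  have "- f s t = inc_mult (reduced_kernel \<kappa>) f s t - chow_function \<kappa> s t +
      (\<Sum>w\<in>{s<..<t}. chow_function \<kappa> s w * inc_mult (reduced_kernel \<kappa>) f w t)"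
    unfolding chow_mult_KLS[symmetric] inc_mult_def[of "chow_function \<kappa>"]
    using assms by (simp add: sum_interval_split locally_finite)
  also have "(\<Sum>w\<in>{s<..<t}. chow_function \<kappa> s w * inc_mult (reduced_kernel \<kappa>) f w t) =
      (\<Sum>w\<in>{s<..<t}. chow_function \<kappa> s w * rev_quotient (\<rho> w t) (f w t))"
    by (intro sum.cong refl) (simp add: reduced_kernel_KLS)
  finally show ?thesis
    using assms by (simp add: reduced_kernel_KLS algebra_simps)
qed

lemma chow_recursion_left:
  assumes "s < t"
  shows "chow_function \<kappa> s t = (g s t + rev_quotient (\<rho> s t) (g s t)) +
    (\<Sum>w\<in>{s<..<t}. rev_quotient (\<rho> s w) (g s w) * chow_function \<kappa> w t)"
proof -
  have "- g s t = - chow_function \<kappa> s t + inc_mult g (reduced_kernel \<kappa>) s t +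
      (\<Sum>w\<in>{s<..<t}. inc_mult g (reduced_kernel \<kappa>) s w * chow_function \<kappa> w t)"
    unfolding chow_mult_KLS[symmetric] inc_mult_def[of _ "chow_function \<kappa>"]
    using assms by (simp add: sum_interval_split locally_finite)
  also have "(\<Sum>w\<in>{s<..<t}. inc_mult g (reduced_kernel \<kappa>) s w * chow_function \<kappa> w t) =
      (\<Sum>w\<in>{s<..<t}. rev_quotient (\<rho> s w) (g s w) * chow_function \<kappa> w t)"
    by (intro sum.cong refl) (simp add: reduced_kernel_KLS)
  finally show ?thesis
    using assms by (simp add: reduced_kernel_KLS algebra_simps)
qed

text \<open>The recursion involves only intervals with lower end \<open>s\<close>, so the induction
  varies \<open>t\<close> alone. In each product the centres (\<open>\<rho> s w\<close> - 1) / 2 and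
  \<open>\<rho> w t\<close> / 2 add up to the required one.\<close>

lemma chow_centred_right:
  assumes "\<And>s t. s \<le> t \<Longrightarrow> nonneg_coeffs (f s t)"
  shows "s < t \<Longrightarrow> chow_function \<kappa> s t \<in> centred (\<rho> s t - 1)"
proof (induction "card {s..t}" arbitrary: t rule: less_induct)
  case less
  show ?case
    unfolding chow_recursion_right[OF less.prems]
  proof (rule centred.add[OF add_rev_quotient_centred centred_sum])
    fix w assume "w \<in> {s<..<t}"
    then have w: "s < w" "w < t" by auto
    have "chow_function \<kappa> s w * rev_quotient (\<rho> w t) (f w t) \<in> centred (\<rho> s w - 1 + \<rho> w t)"
      using w assms
      by (intro centred_mult rev_quotient_centred less.hyps KLS_degree card_interval_less
          locally_finite) auto
    \<comment> \<open>Positivity of \<open>\<rho> s w\<close> makes the truncated subtraction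
      exact.\<close>
    also have "\<rho> s w - 1 + \<rho> w t = \<rho> s t - 1"
      using w rank_add[of s w t] rank_pos[of s w] by simp
    finally show "chow_function \<kappa> s w * rev_quotient (\<rho> w t) (f w t) \<in> centred (\<rho> s t - 1)" .
  qed (use less.prems assms KLS_degree in auto)
qed

text \<open>Dually, the upper end \<open>t\<close> is fixed and \<open>s\<close> varies.\<close>

lemma chow_centred_left:
  assumes "\<And>s t. s \<le> t \<Longrightarrow> nonneg_coeffs (g s t)"
  shows "s < t \<Longrightarrow> chow_function \<kappa> s t \<in> centred (\<rho> s t - 1)"
proof (induction "card {s..t}" arbitrary: s rule: less_induct)
  case less
  show ?case
    unfolding chow_recursion_left[OF less.prems]
  proof (rule centred.add[OF add_rev_quotient_centred centred_sum])
    fix w assume "w \<in> {s<..<t}"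
    then have w: "s < w" "w < t" by auto
    have "rev_quotient (\<rho> s w) (g s w) * chow_function \<kappa> w t \<in> centred (\<rho> s w + (\<rho> w t - 1))"
      using w assms
      by (intro centred_mult rev_quotient_centred less.hyps KLS_degree card_interval_less
          locally_finite) auto
    also have "\<rho> s w + (\<rho> w t - 1) = \<rho> s t - 1"
      using w rank_add[of s w t] rank_pos[of w t] by simp
    finally show "rev_quotient (\<rho> s w) (g s w) * chow_function \<kappa> w t \<in> centred (\<rho> s t - 1)" .
  qed (use less.prems assms KLS_degree in auto)
qed

end

end

theorem theorem3p12:
  fixes \<rho> :: "'a::order \<Rightarrow> 'a \<Rightarrow> nat"
    and \<kappa> f g :: "'a \<Rightarrow> 'a \<Rightarrow> int poly"
  assumes locally_finite: "\<forall>s t :: 'a. finite {s..t}"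
    and "weak_rank \<rho>"
    and "is_kernel \<rho> \<kappa>"
    and "is_right_KLS \<rho> \<kappa> f"
    and "is_left_KLS \<rho> \<kappa> g"
    and "(\<forall>s t. s \<le> t \<longrightarrow> nonneg_coeffs (f s t)) \<or> (\<forall>s t. s \<le> t \<longrightarrow> nonneg_coeffs (g s t))"
  shows "\<forall>s t. s \<le> t \<longrightarrow>
           nonneg_coeffs (chow_function \<kappa> s t) \<and> unimodal (chow_function \<kappa> s t)"
proof (intro allI impI)
  fix s t :: 'a
  assume "s \<le> t"
  note ctxt = locally_finite[rule_format] assms(2-5)
  have "chow_function \<kappa> s t \<in> centred (\<rho> s t - 1)"
  proof (cases "s = t")
    case True
    \<comment> \<open>The constant 1 is the run of length one, and \<open>\<rho> s s - 1\<close> is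
      0 by truncation.\<close>
    then show ?thesis
      using centred.run[of 0 1 0] rank_refl[OF ctxt] chow_refl[OF ctxt]
      by (simp add: geom_poly_def)
  next
    case False
    with \<open>s \<le> t\<close> have "s < t" by simp
    from assms(6) show ?thesis
    proof
      assume "\<forall>s t. s \<le> t \<longrightarrow> nonneg_coeffs (f s t)"
      then show ?thesis
        using \<open>s < t\<close> by (intro chow_centred_right[OF ctxt]) auto
    next
      assume "\<forall>s t. s \<le> t \<longrightarrow> nonneg_coeffs (g s t)"
      then show ?thesis
        using \<open>s < t\<close> by (intro chow_centred_left[OF ctxt]) auto
    qed
  qed
  then show "nonneg_coeffs (chow_function \<kappa> s t) \<and> unimodal (chow_function \<kappa> s t)"
    by (simp add: centred_imp_nonneg_coeffs centred_imp_unimodal)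
qed

end
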